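(* Let $X$ be an order continuous Banach lattice and $(x_n)$ a norm bounded sequence in $X$. If $x_n\xrightarrow{\rm uo}0$ in $X$, then there exist a subsequence $(x_{n_k})$ of $(x_n)$ and a disjoint sequence $(d_k)$ in $X$ such that $\|x_{n_k}-d_k\|\to 0$.
   Context: A Banach lattice is order continuous if $x_\alpha\downarrow 0$ implies $\|x_\alpha\|\to 0$ for every net. A sequence $(d_k)$ is disjoint if $|d_k|\wedge|d_j|=0$ for $k\ne j$. A net (in particular, a sequence) $(x_\alpha)_{\alpha\in\Gamma}$ in $X$ converges in order to $x$ ($x_\alpha\xrightarrow{\rm o}x$) if there is a net $(a_\gamma)_{\gamma\in\Lambda}$ in $X$ with $a_\gamma\downarrow 0$ such that for every $\gamma$ there is $\alpha_0$ with $|x_\alpha-x|\le a_\gamma$ for all $\alpha\ge\alpha_0$; it uo-converges to $x$ ($x_\alpha\xrightarrow{\rm uo}x$) if $|x_\alpha-x|\wedge y\xrightarrow{\rm o}0$ for every $y\in X_+$. *)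

theory Defs
  imports Complex_Main "HOL-Library.Lattice_Algebras"
begin

text \<open>In \<open>lattice_ab_group_add_abs\<close> the absolute value is the lattice one,
  \<open>\<bar>x\<bar> = sup x (- x)\<close>.\<close>

class banach_lattice = banach + ordered_real_vector + lattice_ab_group_add_abs +
  assumes norm_mono_abs: "\<bar>x\<bar> \<le> \<bar>y\<bar> \<Longrightarrow> norm x \<le> norm y"

text \<open>A net is a function on the carrier \<open>I\<close> of a nonempty upward directed preorder \<open>le\<close>.\<close>

definition directed_set :: "'i set \<Rightarrow> ('i \<Rightarrow> 'i \<Rightarrow> bool) \<Rightarrow> bool" where
  "directed_set I le \<longleftrightarrow> I \<noteq> {} \<and> reflp_on I le \<and> transp_on I le \<and>
     (\<forall>i\<in>I. \<forall>j\<in>I. \<exists>k\<in>I. le i k \<and> le j k)"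

definition decreases_to ::
    "'i set \<Rightarrow> ('i \<Rightarrow> 'i \<Rightarrow> bool) \<Rightarrow> ('i \<Rightarrow> 'a::order) \<Rightarrow> 'a \<Rightarrow> bool" where
  "decreases_to I le x l \<longleftrightarrow>
     (\<forall>i\<in>I. \<forall>j\<in>I. le i j \<longrightarrow> x j \<le> x i) \<and>
     (\<forall>i\<in>I. l \<le> x i) \<and> (\<forall>b. (\<forall>i\<in>I. b \<le> x i) \<longrightarrow> b \<le> l)"

definition net_tendsto_norm ::
    "'i set \<Rightarrow> ('i \<Rightarrow> 'i \<Rightarrow> bool) \<Rightarrow> ('i \<Rightarrow> 'a::real_normed_vector) \<Rightarrow> 'a \<Rightarrow> bool" where
  "net_tendsto_norm I le x l \<longleftrightarrow>
     (\<forall>e>0. \<exists>i0\<in>I. \<forall>i\<in>I. le i0 i \<longrightarrow> norm (x i - l) < e)"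

text \<open>HOL cannot quantify over the type of the index set of a net. In the next two definitions the
  bound nets are indexed by subsets of \<open>X\<close> itself (under an arbitrary directed preorder). Nothing is
  lost: a decreasing net can be replaced by its range, directed by \<open>\<ge>\<close>. The two lemmas
  \<open>order_continuous_net\<close> and \<open>order_convergesI\<close> below prove this for an arbitrary index type.\<close>

definition order_continuous :: "'a::banach_lattice itself \<Rightarrow> bool" where
  "order_continuous _ \<longleftrightarrow>
     (\<forall>(I::'a set) le (x::'a \<Rightarrow> 'a).
        directed_set I le \<and> decreases_to I le x 0 \<longrightarrow> net_tendsto_norm I le x 0)"

definition order_converges ::
    "'i set \<Rightarrow> ('i \<Rightarrow> 'i \<Rightarrow> bool) \<Rightarrow> ('i \<Rightarrow> 'a::banach_lattice) \<Rightarrow> 'a \<Rightarrow> bool" where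
  "order_converges I le x l \<longleftrightarrow>
     (\<exists>(G::'a set) leG (a::'a \<Rightarrow> 'a).
        directed_set G leG \<and> decreases_to G leG a 0 \<and>
        (\<forall>g\<in>G. \<exists>i0\<in>I. \<forall>i\<in>I. le i0 i \<longrightarrow> \<bar>x i - l\<bar> \<le> a g))"

definition uo_converges ::
    "'i set \<Rightarrow> ('i \<Rightarrow> 'i \<Rightarrow> bool) \<Rightarrow> ('i \<Rightarrow> 'a::banach_lattice) \<Rightarrow> 'a \<Rightarrow> bool" where
  "uo_converges I le x l \<longleftrightarrow>
     (\<forall>y\<ge>0. order_converges I le (\<lambda>i. inf \<bar>x i - l\<bar> y) 0)"

definition disjoint_seq :: "(nat \<Rightarrow> 'a::banach_lattice) \<Rightarrow> bool" where
  "disjoint_seq d \<longleftrightarrow> (\<forall>k j. k \<noteq> j \<longrightarrow> inf \<bar>d k\<bar> \<bar>d j\<bar> = 0)"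

lemma directed_set_range:
  fixes x :: "'i \<Rightarrow> 'a::order"
  assumes "directed_set I le" and "decreases_to I le x l"
  shows "directed_set (x ` I) (\<ge>)" and "decreases_to (x ` I) (\<ge>) (\<lambda>z. z) l"
proof -
  have "\<exists>c\<in>x ` I. c \<le> a \<and> c \<le> b" if "a \<in> x ` I" "b \<in> x ` I" for a b
  proof -
    obtain i j where ij: "i \<in> I" "j \<in> I" "a = x i" "b = x j" using \<open>a \<in> x ` I\<close> \<open>b \<in> x ` I\<close> by blast
    then obtain k where "k \<in> I" "le i k" "le j k" using assms(1) by (auto simp: directed_set_def)
    then show ?thesis using ij assms(2) by (auto simp: decreases_to_def)
  qed
  then show "directed_set (x ` I) (\<ge>)"
    using assms(1) by (auto simp: directed_set_def intro!: reflp_onI transp_onI)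
  show "decreases_to (x ` I) (\<ge>) (\<lambda>z. z) l"
    using assms(2) by (auto simp: decreases_to_def)
qed

lemma order_continuous_net:
  fixes x :: "'i \<Rightarrow> 'a::banach_lattice"
  assumes "order_continuous TYPE('a)" and "directed_set I le" and dec: "decreases_to I le x 0"
  shows "net_tendsto_norm I le x 0"
  unfolding net_tendsto_norm_def
proof (intro allI impI)
  fix e :: real assume "e > 0"
  have "net_tendsto_norm (x ` I) (\<ge>) (\<lambda>z. z) 0"
    using assms directed_set_range[OF assms(2,3)] unfolding order_continuous_def by blast
  then obtain i0 where i0: "i0 \<in> I" "norm (x i0) < e"
    using \<open>e > 0\<close> unfolding net_tendsto_norm_def by fastforce
  have "norm (x i - 0) < e" if "i \<in> I" "le i0 i" for i
  proof -
    have "0 \<le> x i" "x i \<le> x i0" using dec i0(1) that by (auto simp: decreases_to_def)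
    then have "\<bar>x i\<bar> \<le> \<bar>x i0\<bar>" by (simp add: order_trans[OF _ abs_ge_self])
    then show ?thesis using norm_mono_abs i0(2) by fastforce
  qed
  then show "\<exists>i0\<in>I. \<forall>i\<in>I. le i0 i \<longrightarrow> norm (x i - 0) < e" using i0(1) by blast
qed

lemma order_convergesI:
  fixes x :: "'i \<Rightarrow> 'a::banach_lattice" and a :: "'g \<Rightarrow> 'a"
  assumes "directed_set G leG" and "decreases_to G leG a 0"
    and "\<And>g. g \<in> G \<Longrightarrow> \<exists>i0\<in>I. \<forall>i\<in>I. le i0 i \<longrightarrow> \<bar>x i - l\<bar> \<le> a g"
  shows "order_converges I le x l"
  unfolding order_converges_def
  by (rule exI[of _ "a ` G"], rule exI[of _ "(\<ge>)"], rule exI[of _ "\<lambda>z. z"])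
     (use directed_set_range[OF assms(1,2)] assms(3) in auto)

end

theory Submission
  imports Defs
begin

text \<open>Order continuity turns uo-convergence into \<open>norm (inf \<bar>x n\<bar> y) \<longlonglongrightarrow> 0\<close> for all \<open>y \<ge> 0\<close>, so a
  subsequence \<open>v\<close> has \<open>norm (inf \<bar>v k\<bar> \<bar>v i\<bar>) \<le> C / 2 ^ (k + i)\<close> for \<open>i \<noteq> k\<close>. Put
  \<open>w k = (\<Sum>i. if i = k then 0 else inf \<bar>v k\<bar> \<bar>v i\<bar>)\<close>; then \<open>norm (w k)\<close> tends to zero, and
  \<open>d k\<close> is \<open>v k\<close> minus its truncation to the order interval from \<open>- w k\<close> to \<open>w k\<close>. Since
  \<open>\<bar>d k\<bar> \<le> sup 0 (\<bar>v k\<bar> - w k) \<le> \<bar>v k\<bar> - inf \<bar>v k\<bar> \<bar>v j\<bar>\<close> for \<open>j \<noteq> k\<close>, the \<open>d k\<close> are disjoint.\<close>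

lemma norm_abs_lattice [simp]: "norm \<bar>y\<bar> = norm (y::'a::banach_lattice)"
  by (intro antisym norm_mono_abs) simp_all

lemma norm_mono_nonneg:
  fixes y z :: "'a::banach_lattice"
  assumes "0 \<le> y" "y \<le> z"
  shows "norm y \<le> norm z"
  using assms by (intro norm_mono_abs) (simp add: abs_of_nonneg)

lemma tendsto_abs_lattice:
  fixes f :: "'b \<Rightarrow> 'a::banach_lattice"
  assumes "(f \<longlongrightarrow> l) F"
  shows "((\<lambda>n. \<bar>f n\<bar>) \<longlongrightarrow> \<bar>l\<bar>) F"
proof -
  have "norm (\<bar>f n\<bar> - \<bar>l\<bar>) \<le> norm (f n - l)" for n
    by (intro norm_mono_abs abs_triangle_ineq3)
  then show ?thesis
    using assms unfolding tendsto_iff dist_norm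
    by (meson eventually_mono le_less_trans)
qed

text \<open>The positive cone is norm closed: since the modulus is norm continuous, the sequence of
  moduli tends to both \<open>l\<close> and \<open>\<bar>l\<bar>\<close>, so these agree.\<close>

lemma lim_nonneg_lattice:
  fixes f :: "nat \<Rightarrow> 'a::banach_lattice"
  assumes "f \<longlonglongrightarrow> l" and "\<forall>\<^sub>F n in sequentially. 0 \<le> f n"
  shows "0 \<le> l"
proof -
  have "(\<lambda>n. \<bar>f n\<bar>) \<longlonglongrightarrow> l"
    using assms(1)
    by (rule Lim_transform_eventually)
      (use assms(2) in \<open>auto elim!: eventually_mono simp: abs_of_nonneg\<close>)
  then have "\<bar>l\<bar> = l"
    using tendsto_abs_lattice[OF assms(1)] LIMSEQ_unique by blast
  then show ?thesis by (metis abs_ge_zero)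
qed

lemma suminf_ge_term_lattice:
  fixes f :: "nat \<Rightarrow> 'a::banach_lattice"
  assumes "summable f" and "\<And>i. 0 \<le> f i"
  shows "f j \<le> suminf f"
proof -
  have "(\<lambda>n. sum f {..<n} - f j) \<longlonglongrightarrow> suminf f - f j"
    by (intro tendsto_diff summable_LIMSEQ assms(1) tendsto_const)
  moreover have "\<forall>\<^sub>F n in sequentially. 0 \<le> sum f {..<n} - f j"
    using eventually_gt_at_top[of j]
  proof eventually_elim
    case (elim n)
    then have "sum f {..<n} = f j + sum f ({..<n} - {j})"
      by (simp add: sum.remove)
    then show ?case using assms(2) by (simp add: sum_nonneg)
  qed
  ultimately have "0 \<le> suminf f - f j" by (rule lim_nonneg_lattice)
  then show ?thesis by simp
qed

text \<open>Translations preserve infima, so removing the common part \<open>inf a b\<close> from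
  both elements leaves disjoint remainders.\<close>

lemma inf_diff_inf_eq_zero:
  fixes a b :: "'a::lattice_ab_group_add"
  shows "inf (a - inf a b) (b - inf a b) = 0"
  using add_inf_distrib_right[of a b "- inf a b", symmetric]
  by (simp only: diff_conv_add_uminus add.right_inverse)

text \<open>The order bounds decrease to zero, so order continuity yields one of norm below
  \<open>e\<close>; that single bound dominates a whole tail of the sequence.\<close>

lemma uo_converges_imp_norm_inf_tendsto:
  fixes x :: "nat \<Rightarrow> 'a::banach_lattice"
  assumes oc: "order_continuous TYPE('a)"
    and uo: "uo_converges UNIV (\<le>) x 0" and "0 \<le> y"
  shows "(\<lambda>n. norm (inf \<bar>x n\<bar> y)) \<longlonglongrightarrow> 0"
proof (rule LIMSEQ_I)
  fix e :: real assume "e > 0"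
  from uo \<open>0 \<le> y\<close> obtain G :: "'a set" and leG a where G: "directed_set G leG" "decreases_to G leG a 0"
    and b: "\<forall>g\<in>G. \<exists>i0. \<forall>i. i0 \<le> i \<longrightarrow> \<bar>inf \<bar>x i\<bar> y\<bar> \<le> a g"
    unfolding uo_converges_def order_converges_def by auto
  have "net_tendsto_norm G leG a 0" by (rule order_continuous_net[OF oc G])
  then obtain g where "g \<in> G" "norm (a g) < e"
    using \<open>e > 0\<close> G(1) unfolding net_tendsto_norm_def directed_set_def
    by (metis diff_zero reflp_onD)
  moreover obtain n0 where "\<bar>inf \<bar>x n\<bar> y\<bar> \<le> a g" if "n0 \<le> n" for n
    using b \<open>g \<in> G\<close> by blast
  then have "norm (inf \<bar>x n\<bar> y) \<le> norm (a g)" if "n0 \<le> n" for n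
    using norm_mono_nonneg[OF abs_ge_zero, of "inf \<bar>x n\<bar> y" "a g"] that by simp
  ultimately show "\<exists>n0. \<forall>n\<ge>n0. norm (norm (inf \<bar>x n\<bar> y) - 0) < e"
    by (auto intro: le_less_trans)
qed

lemma almost_disjoint_subseq:
  fixes x :: "nat \<Rightarrow> 'a::banach_lattice"
  assumes lim: "\<And>y. 0 \<le> y \<Longrightarrow> (\<lambda>n. norm (inf \<bar>x n\<bar> y)) \<longlonglongrightarrow> 0"
  obtains r :: "nat \<Rightarrow> nat" where "strict_mono r"
    and "\<And>i k. i \<noteq> k \<Longrightarrow> norm (inf \<bar>x (r k)\<bar> \<bar>x (r i)\<bar>) \<le> 4 * (1/2) ^ k * (1/2) ^ i"
proof -
  have "\<exists>b. True \<and> (a < b \<and> (\<forall>i\<le>a. norm (inf \<bar>x b\<bar> \<bar>x i\<bar>) < (1/4) ^ n))" for a n :: nat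
  proof -
    have "\<forall>\<^sub>F b in sequentially. norm (inf \<bar>x b\<bar> \<bar>x i\<bar>) < (1/4) ^ n" for i
      by (rule order_tendstoD(2)[OF lim]) simp_all
    then have "\<forall>\<^sub>F b in sequentially. a < b \<and> (\<forall>i\<in>{..a}. norm (inf \<bar>x b\<bar> \<bar>x i\<bar>) < (1/4) ^ n)"
      by (intro eventually_conj eventually_gt_at_top eventually_ball_finite) auto
    then show ?thesis
      unfolding eventually_sequentially by blast
  qed
  then obtain r :: "nat \<Rightarrow> nat" where r: "\<And>n. r n < r (Suc n)"
    "\<And>n i. i \<le> r n \<Longrightarrow> norm (inf \<bar>x (r (Suc n))\<bar> \<bar>x i\<bar>) < (1/4) ^ n"
    using dependent_nat_choice[of "\<lambda>_ _. True"
        "\<lambda>n a b. a < b \<and> (\<forall>i\<le>a. norm (inf \<bar>x b\<bar> \<bar>x i\<bar>) < (1/4) ^ n)"] by blast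
  have mono: "strict_mono r" using r(1) by (simp add: strict_mono_Suc_iff)
  have less: "norm (inf \<bar>x (r k)\<bar> \<bar>x (r i)\<bar>) \<le> 4 * (1/2) ^ k * (1/2) ^ i" if "i < k" for i k
  proof -
    obtain m where m: "k = Suc m" "i \<le> m" using \<open>i < k\<close> by (cases k) auto
    have "norm (inf \<bar>x (r k)\<bar> \<bar>x (r i)\<bar>) < (1/4) ^ m"
      using r(2)[of "r i" m] m mono by (simp add: strict_mono_less_eq)
    \<comment> \<open>The rate 1/4 is split into two factors 1/2, one of which is weakened from
      \<open>k\<close> to \<open>i\<close>. The bound becomes symmetric and summable in either
      index; the 4 pays for the shift \<open>k = Suc m\<close>.\<close>
    also have "(1/4::real) ^ m = 4 * (1/2) ^ k * (1/2) ^ k"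
      by (simp add: m power_mult_distrib[symmetric])
    also have "\<dots> \<le> 4 * (1/2) ^ k * (1/2) ^ i"
      using \<open>i < k\<close> by (intro mult_left_mono power_decreasing) auto
    finally show ?thesis by simp
  qed
  have "norm (inf \<bar>x (r k)\<bar> \<bar>x (r i)\<bar>) \<le> 4 * (1/2) ^ k * (1/2) ^ i" if "i \<noteq> k" for i k
    using less[of i k] less[of k i] that by (cases "i < k") (auto simp: inf_commute mult_ac)
  with mono show thesis by (rule that)
qed

definition truncate :: "'a::lattice_ab_group_add \<Rightarrow> 'a \<Rightarrow> 'a" where
  "truncate w v = inf (sup v (- w)) w"

lemma abs_truncate_le:
  fixes v w :: "'a::lattice_ab_group_add_abs"
  assumes "0 \<le> w"
  shows "\<bar>truncate w v\<bar> \<le> w"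
proof (rule abs_leI)
  show "truncate w v \<le> w" by (simp add: truncate_def)
  have "- w \<le> w" using assms by (meson neg_le_0_iff_le order_trans)
  then have "- w \<le> truncate w v" by (simp add: truncate_def)
  then show "- truncate w v \<le> w" by (simp add: minus_le_iff)
qed

text \<open>With \<open>s\<close> the right-hand side, \<open>v - s\<close> lies below both
  \<open>v\<close> and \<open>w\<close>, hence below the truncation, while \<open>v + s\<close> lies
  above both \<open>v\<close> and \<open>- w\<close>, hence above it.\<close>

lemma abs_diff_truncate_le:
  fixes v w :: "'a::lattice_ab_group_add_abs"
  shows "\<bar>v - truncate w v\<bar> \<le> sup 0 (\<bar>v\<bar> - w)"
proof (rule abs_leI)
  define s where "s = sup 0 (\<bar>v\<bar> - w)"
  have s: "0 \<le> s" "\<bar>v\<bar> - w \<le> s" by (simp_all add: s_def)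
  have "v - w \<le> s" "- w - v \<le> s"
    using s(2) by (metis abs_ge_self abs_ge_minus_self diff_right_mono minus_diff_commute order_trans)+
  then have "v - s \<le> v" "v - s \<le> w" "v \<le> v + s" "- w \<le> v + s"
    using s(1) by (simp_all add: diff_le_eq le_diff_eq minus_le_iff add_ac)
  then have "v - s \<le> truncate w v" "truncate w v \<le> v + s"
    by (auto simp: truncate_def intro: le_supI1 le_infI1)
  then show "v - truncate w v \<le> sup 0 (\<bar>v\<bar> - w)" "- (v - truncate w v) \<le> sup 0 (\<bar>v\<bar> - w)"
    unfolding s_def[symmetric] by (simp_all add: algebra_simps)
qed

theorem lemma6p7:
  fixes x :: "nat \<Rightarrow> 'a::banach_lattice"
  assumes "order_continuous TYPE('a)"
    and "Bseq x"
    and "uo_converges UNIV (\<le>) x 0"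
  shows "\<exists>(r :: nat \<Rightarrow> nat) (d :: nat \<Rightarrow> 'a).
           strict_mono r \<and> disjoint_seq d \<and>
           (\<lambda>k. norm (x (r k) - d k)) \<longlonglongrightarrow> 0"
proof -
  obtain r :: "nat \<Rightarrow> nat" where r: "strict_mono r"
    and small: "\<And>i k. i \<noteq> k \<Longrightarrow> norm (inf \<bar>x (r k)\<bar> \<bar>x (r i)\<bar>) \<le> 4 * (1/2) ^ k * (1/2) ^ i"
    using almost_disjoint_subseq[OF uo_converges_imp_norm_inf_tendsto[OF assms(1,3)]] by blast
  define v where "v k = x (r k)" for k
  define m where "m k i = inf \<bar>v k\<bar> \<bar>v i\<bar>" for k i
  \<comment> \<open>The diagonal is zeroed because \<open>m k k\<close> is
    \<open>\<bar>v k\<bar>\<close>, which need not be small.\<close>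
  define u where "u k i = (if i = k then 0 else m k i)" for k i
  define w where "w k = suminf (u k)" for k
  define d where "d k = v k - truncate (w k) (v k)" for k
  have u_nonneg: "0 \<le> u k i" for k i by (simp add: u_def m_def)
  have u_le: "norm (u k i) \<le> 4 * (1/2) ^ k * (1/2) ^ i" for k i
    using small by (simp add: u_def m_def v_def)
  have bound: "(\<lambda>i. 4 * (1/2) ^ k * (1/2) ^ i) sums (8 * (1/2::real) ^ k)" for k
    using sums_mult[OF geometric_sums[of "1/2::real"], of "4 * (1/2) ^ k"] by simp
  have norm_summable: "summable (\<lambda>i. norm (u k i))" for k
    by (rule summable_comparison_test'[OF sums_summable[OF bound[of k]]]) (use u_le in auto)
  have w_ge: "u k i \<le> w k" for k i
    unfolding w_def by (rule suminf_ge_term_lattice[OF summable_norm_cancel[OF norm_summable] u_nonneg])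
  have w_nonneg: "0 \<le> w k" for k using u_nonneg w_ge order_trans by blast
  have w_norm: "norm (w k) \<le> 8 * (1/2) ^ k" for k
  proof -
    have "norm (w k) \<le> (\<Sum>i. norm (u k i))"
      unfolding w_def by (rule summable_norm[OF norm_summable])
    also have "\<dots> \<le> 8 * (1/2) ^ k"
      unfolding sums_unique[OF bound] by (rule suminf_le[OF u_le norm_summable sums_summable[OF bound]])
    finally show ?thesis .
  qed
  \<comment> \<open>The one element \<open>w k\<close> dominates the overlap of \<open>v k\<close>
    with every other \<open>v j\<close>, so \<open>d k\<close> serves all \<open>j\<close> at
    once.\<close>
  have d_le: "\<bar>d k\<bar> \<le> \<bar>v k\<bar> - m k j" if "k \<noteq> j" for k j
  proof -
    have "m k j \<le> \<bar>v k\<bar>" by (simp add: m_def)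
    moreover have "m k j \<le> w k" using w_ge[of k j] that by (simp add: u_def)
    ultimately have "sup 0 (\<bar>v k\<bar> - w k) \<le> \<bar>v k\<bar> - m k j"
      by (simp add: diff_left_mono)
    with abs_diff_truncate_le show ?thesis unfolding d_def by (rule order_trans)
  qed
  have "disjoint_seq d"
    unfolding disjoint_seq_def
  proof (intro allI impI)
    fix k j :: nat assume "k \<noteq> j"
    \<comment> \<open>By symmetry of \<open>m\<close>, the same element \<open>m k j\<close> is
      subtracted on both sides.\<close>
    then have "inf \<bar>d k\<bar> \<bar>d j\<bar> \<le> inf (\<bar>v k\<bar> - m k j) (\<bar>v j\<bar> - m k j)"
      using d_le[of k j] d_le[of j k] by (intro inf_mono) (auto simp: m_def inf_commute)
    also have "\<dots> = 0" unfolding m_def by (rule inf_diff_inf_eq_zero)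
    finally show "inf \<bar>d k\<bar> \<bar>d j\<bar> = 0" by (intro antisym) simp_all
  qed
  moreover have "(\<lambda>k. norm (x (r k) - d k)) \<longlonglongrightarrow> 0"
  proof (rule tendsto_0_le[where K = 1])
    \<comment> \<open>The difference is exactly the truncation of \<open>v k\<close>, whose modulus
      is at most \<open>w k\<close>.\<close>
    have "norm (x (r k) - d k) \<le> 8 * (1/2) ^ k" for k
      using norm_mono_nonneg[OF abs_ge_zero abs_truncate_le[OF w_nonneg[of k], of "v k"]] w_norm[of k]
      by (simp add: d_def v_def)
    then show "\<forall>\<^sub>F k in sequentially. norm (norm (x (r k) - d k)) \<le> norm (8 * (1/2::real) ^ k) * 1"
      by simp
    show "(\<lambda>k. 8 * (1/2::real) ^ k) \<longlonglongrightarrow> 0"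
      by (rule tendsto_mult_right_zero[OF LIMSEQ_power_zero]) simp
  qed
  ultimately show ?thesis using r by blast
qed

end
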